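(* Let $S$ be an additively reduced and additively atomic semidomain. (A) The following statements are equivalent: (1) $\mathcal{A}_{+}(S) = S^{\times}$; (2) every $f \in S[x^{\pm 1}]$ with $|\mathrm{supp}(f)| > 1$ can be expressed as the sum of at most two multiplicative irreducibles of $S[x^{\pm 1}]$; (3) there exists a positive integer $k$ such that every $f \in S[x^{\pm 1}]$ with $|\mathrm{supp}(f)| > 1$ can be expressed as the sum of at most $k$ multiplicative irreducibles of $S[x^{\pm 1}]$. (B) Moreover, suppose that any of the statements in (A) holds, and let $f \in S[x^{\pm 1}]$ with $|\mathrm{supp}(f)| > 1$ be such that $f$ does not have either of the following forms (with distinct integer exponents): (a) $f = ax^{k_0} + bx^{k_1}$ with $a, b \in S\setminus\{0\}$, where either $a \in S^{\times}$ or $b \in S^{\times}$; (b) $f = ax^{k_0} + bx^{k_1} + cx^{k_2}$, where $a, b, c \in S^{\times}$. Then $f$ is the sum of exactly two multiplicative irreducibles of $S[x^{\pm 1}]$, i.e., $f = g + h$ for some multiplicative irreducibles $g, h \in S[x^{\pm 1}]$.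
   Context: A semidomain is a subsemiring of an integral domain, i.e., a subset $S$ of an integral domain containing $0$ and $1$ and closed under addition and multiplication. $S^{\times}$ denotes the group of units of the multiplicative monoid $S^* = S\setminus\{0\}$ (elements having a multiplicative inverse in $S$). $\mathcal{A}_{+}(S)$ is the set of atoms of the additive monoid $(S,+)$: elements $a$ that are not additively invertible in $S$ and such that $a = b + c$ with $b, c \in S$ implies that $b$ or $c$ is additively invertible in $S$. $S$ is additively reduced if $0$ is the only invertible element of $(S,+)$. $S$ is additively atomic if every non-invertible element of $(S,+)$ is a sum of finitely many atoms of $(S,+)$. $S[x^{\pm 1}]$ is the semidomain of Laurent polynomials with coefficients in $S$; $\mathrm{supp}(f)$ is the set of exponents of $f$ with nonzero coefficient. A multiplicative irreducible of a semidomain $T$ is a nonzero non-unit $a \in T$ such that $a = bc$ with $b, c \in T$ implies $b \in T^{\times}$ or $c \in T^{\times}$. *)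

theory Defs
  imports Main "HOL-Library.Poly_Mapping"
begin

text \<open>
  Semidomains are subsets of an ambient integral domain, given as a type of class
  \<^class>\<open>idom\<close>. All notions below are relative to the subset, never to the ambient domain.
\<close>

definition semidomain :: "'a::idom set \<Rightarrow> bool" where
  "semidomain S \<longleftrightarrow>
     0 \<in> S \<and> 1 \<in> S \<and> (\<forall>a\<in>S. \<forall>b\<in>S. a + b \<in> S) \<and> (\<forall>a\<in>S. \<forall>b\<in>S. a * b \<in> S)"

definition mult_units :: "'a::idom set \<Rightarrow> 'a set" where
  "mult_units S = {u \<in> S - {0}. \<exists>v\<in>S - {0}. u * v = 1}"

definition mult_irreducibles :: "'a::idom set \<Rightarrow> 'a set" where
  "mult_irreducibles S =
     {a \<in> S. a \<noteq> 0 \<and> a \<notin> mult_units S \<and>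
        (\<forall>b\<in>S. \<forall>c\<in>S. a = b * c \<longrightarrow> b \<in> mult_units S \<or> c \<in> mult_units S)}"

definition add_units :: "'a::idom set \<Rightarrow> 'a set" where
  "add_units S = {a \<in> S. \<exists>b\<in>S. a + b = 0}"

definition add_atoms :: "'a::idom set \<Rightarrow> 'a set" where
  "add_atoms S =
     {a \<in> S. a \<notin> add_units S \<and>
        (\<forall>b\<in>S. \<forall>c\<in>S. a = b + c \<longrightarrow> b \<in> add_units S \<or> c \<in> add_units S)}"

definition additively_reduced :: "'a::idom set \<Rightarrow> bool" where
  "additively_reduced S \<longleftrightarrow> add_units S = {0}"

definition additively_atomic :: "'a::idom set \<Rightarrow> bool" where
  "additively_atomic S \<longleftrightarrow>
     (\<forall>a\<in>S - add_units S. \<exists>as. set as \<subseteq> add_atoms S \<and> sum_list as = a)"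

text \<open>
  Laurent polynomials over the ambient domain are the finitely supported functions
  \<^typ>\<open>int \<Rightarrow>\<^sub>0 'a\<close> with convolution product, an instance of \<^class>\<open>idom\<close>.
  The support of \<open>f\<close> is \<open>Poly_Mapping.keys f\<close>, and the monomial with coefficient \<open>a\<close> and
  exponent \<open>k\<close> is \<open>Poly_Mapping.single k a\<close>.
\<close>

definition laurent_polys :: "'a::idom set \<Rightarrow> (int \<Rightarrow>\<^sub>0 'a) set" where
  "laurent_polys S = {f. \<forall>k. Poly_Mapping.lookup f k \<in> S}"

definition sum_of_at_most_irreducibles :: "nat \<Rightarrow> 'a::idom set \<Rightarrow> 'a \<Rightarrow> bool" where
  "sum_of_at_most_irreducibles n T f \<longleftrightarrow>
     (\<exists>gs. length gs \<le> n \<and> set gs \<subseteq> mult_irreducibles T \<and> sum_list gs = f)"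

definition laurent_goldbach :: "nat \<Rightarrow> 'a::idom set \<Rightarrow> bool" where
  "laurent_goldbach n S \<longleftrightarrow>
     (\<forall>f\<in>laurent_polys S. card (Poly_Mapping.keys f) > 1 \<longrightarrow>
        sum_of_at_most_irreducibles n (laurent_polys S) f)"

definition binomial_with_unit_coeff :: "'a::idom set \<Rightarrow> (int \<Rightarrow>\<^sub>0 'a) \<Rightarrow> bool" where
  "binomial_with_unit_coeff S f \<longleftrightarrow>
     (\<exists>a\<in>S - {0}. \<exists>b\<in>S - {0}. \<exists>k0 k1. k0 \<noteq> k1 \<and>
        (a \<in> mult_units S \<or> b \<in> mult_units S) \<and>
        f = Poly_Mapping.single k0 a + Poly_Mapping.single k1 b)"

definition trinomial_with_unit_coeffs :: "'a::idom set \<Rightarrow> (int \<Rightarrow>\<^sub>0 'a) \<Rightarrow> bool" where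
  "trinomial_with_unit_coeffs S f \<longleftrightarrow>
     (\<exists>a\<in>mult_units S. \<exists>b\<in>mult_units S. \<exists>c\<in>mult_units S. \<exists>k0 k1 k2.
        k0 \<noteq> k1 \<and> k0 \<noteq> k2 \<and> k1 \<noteq> k2 \<and>
        f = Poly_Mapping.single k0 a + Poly_Mapping.single k1 b + Poly_Mapping.single k2 c)"

end

theory Submission
  imports Defs
begin

text \<open>
  Sums and products in \<open>S[x\<^sup>\<plusminus>\<^sup>1]\<close> have no cancellation, so supports of products are sumsets of
  supports. If an additive atom \<open>a\<close> is not a unit, then any decomposition of
  \<open>a (1 + x + \<dots> + x\<^sup>k)\<close> into summands distributes the monomials \<open>a x\<^sup>i\<close>, and a summand \<open>a p\<close> is
  irreducible only if it is a monomial; hence more than \<open>k\<close> irreducibles are needed.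

  Conversely, suppose that the atoms are the units. A unit coefficient at \<open>e\<close> rules out monomial
  non-unit factors and forces \<open>e\<close> to have only one representation in the sumset of the supports of
  two factors, so irreducibility follows from a condition on the support alone. It remains to cover
  the support of \<open>f\<close> by two sets satisfying that condition: the minimal exponent together with the
  exponents above the midpoint, and the maximal exponent together with those below the midpoint, up
  to small corrections. In a set of the first kind all distances from the minimal
  exponent exceed half of the diameter, which leaves no room for a sumset.
\<close>

section \<open>Coefficients of products and polynomials with few exponents\<close>

abbreviation coef :: "('k \<Rightarrow>\<^sub>0 'a::zero) \<Rightarrow> 'k \<Rightarrow> 'a" where
  "coef \<equiv> Poly_Mapping.lookup"

abbreviation supp :: "('k \<Rightarrow>\<^sub>0 'a::zero) \<Rightarrow> 'k set" where
  "supp \<equiv> Poly_Mapping.keys"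

abbreviation mon :: "'k \<Rightarrow> 'a \<Rightarrow> ('k \<Rightarrow>\<^sub>0 'a::zero)" where
  "mon \<equiv> Poly_Mapping.single"

lemma coef_mult:
  fixes p q :: "'k::ab_group_add \<Rightarrow>\<^sub>0 'a::semiring_0"
  shows "coef (p * q) k = (\<Sum>i\<in>supp p. coef p i * coef q (k - i))"
proof -
  have "(\<Sum>j. coef q j when k = i + j) = coef q (k - i)" for i
    by (subst Sum_any.expand_superset[of "{k - i}"]) (auto simp: when_def algebra_simps)
  then show ?thesis
    unfolding lookup_mult
    by (subst Sum_any.expand_superset[of "supp p"]) (auto simp: in_keys_iff)
qed

lemma poly_mapping_eq_mon:
  assumes "supp f \<subseteq> {k}"
  shows "f = mon k (coef f k)"
proof (rule poly_mapping_eqI)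
  fix i
  show "coef f i = coef (mon k (coef f k)) i"
    using assms by (cases "i = k") (auto simp: lookup_single in_keys_iff)
qed

lemma poly_mapping_eq_mon_add_mon:
  fixes f :: "'k \<Rightarrow>\<^sub>0 'a::comm_monoid_add"
  assumes "supp f = {k0, k1}" and "k0 \<noteq> k1"
  shows "f = mon k0 (coef f k0) + mon k1 (coef f k1)"
  by (rule poly_mapping_eqI)
    (use assms in \<open>auto simp: lookup_single lookup_add when_def in_keys_iff\<close>)

lemma poly_mapping_eq_mon_add_mon_add_mon:
  fixes f :: "'k \<Rightarrow>\<^sub>0 'a::comm_monoid_add"
  assumes "supp f = {k0, k1, k2}" and "k0 \<noteq> k1" "k0 \<noteq> k2" "k1 \<noteq> k2"
  shows "f = mon k0 (coef f k0) + mon k1 (coef f k1) + mon k2 (coef f k2)"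
  by (rule poly_mapping_eqI)
    (use assms in \<open>auto simp: lookup_single lookup_add when_def in_keys_iff\<close>)

lemma card_gt_1_obtain:
  assumes "card A > 1"
  obtains y where "y \<in> A" "y \<noteq> x"
proof -
  have "\<not> A \<subseteq> {x}"
    using assms card_mono[of "{x}" A] by auto
  then show ?thesis using that by blast
qed

section \<open>Laurent polynomials over additively reduced semidomains\<close>

locale reduced_semidomain =
  fixes S :: "'a::idom set"
  assumes semidomain: "semidomain S"
    and reduced: "additively_reduced S"
begin

abbreviation "T \<equiv> laurent_polys S"

lemma zero_closed [simp]: "0 \<in> S"
  and one_closed [simp]: "1 \<in> S"
  and add_closed [simp]: "a \<in> S \<Longrightarrow> b \<in> S \<Longrightarrow> a + b \<in> S"
  and mult_closed [simp]: "a \<in> S \<Longrightarrow> b \<in> S \<Longrightarrow> a * b \<in> S"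
  using semidomain unfolding semidomain_def by auto

lemma add_units_eq [simp]: "add_units S = {0}"
  using reduced unfolding additively_reduced_def .

lemma add_eq_0_imp:
  assumes "a \<in> S" "b \<in> S" "a + b = 0"
  shows "a = 0" "b = 0"
proof -
  have "a \<in> add_units S"
    using assms unfolding add_units_def by auto
  then show "a = 0" by simp
  then show "b = 0" using assms by simp
qed

lemma sum_closed: "(\<And>i. i \<in> A \<Longrightarrow> t i \<in> S) \<Longrightarrow> sum t A \<in> S"
  by (induction A rule: infinite_finite_induct) auto

lemma sum_eq_0_imp:
  assumes "finite A" "\<And>i. i \<in> A \<Longrightarrow> t i \<in> S" "sum t A = 0" "i \<in> A"
  shows "t i = 0"
proof -
  have "t i + sum t (A - {i}) = 0"
    using sum.remove[of A i t] assms by simp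
  then show ?thesis
    using add_eq_0_imp(1) assms(2,4) sum_closed[of "A - {i}" t] by blast
qed

lemma add_atom_add:
  assumes "b + c \<in> add_atoms S" "b \<in> S" "c \<in> S"
  shows "b = 0 \<or> c = 0"
proof -
  have "b \<in> add_units S \<or> c \<in> add_units S"
    using assms unfolding add_atoms_def by blast
  then show ?thesis by simp
qed

text \<open>Splitting off the nonzero term \<open>t i\<close> from the atom leaves a sum equal to 0,
  and additive reducedness then kills every remaining term.\<close>

lemma add_atom_sum_unique:
  assumes "finite A" "\<And>i. i \<in> A \<Longrightarrow> t i \<in> S" "sum t A \<in> add_atoms S"
    and "i \<in> A" "j \<in> A" "t i \<noteq> 0" "t j \<noteq> 0"
  shows "i = j"
proof (rule ccontr)
  assume "i \<noteq> j"
  have "t i + sum t (A - {i}) \<in> add_atoms S"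
    using sum.remove[of A i t] assms by simp
  then have "sum t (A - {i}) = 0"
    using assms add_atom_add[OF _ _ sum_closed] by fastforce
  then have "t j = 0"
    using assms \<open>i \<noteq> j\<close> by (intro sum_eq_0_imp[of "A - {i}" t j]) auto
  then show False using assms by simp
qed

lemma mult_units_iff: "u \<in> mult_units S \<longleftrightarrow> u \<in> S \<and> (\<exists>v\<in>S. u * v = 1)"
  unfolding mult_units_def by force

lemma mult_units_T_iff: "u \<in> mult_units T \<longleftrightarrow> u \<in> T \<and> (\<exists>v\<in>T. u * v = 1)"
  unfolding mult_units_def laurent_polys_def by force

lemma mult_unit_factor:
  assumes "c * d \<in> mult_units S" "c \<in> S" "d \<in> S"
  shows "c \<in> mult_units S"
proof -
  obtain v where "v \<in> S" "c * d * v = 1"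
    using assms(1) unfolding mult_units_iff by auto
  then have "d * v \<in> S" "c * (d * v) = 1"
    using assms by (auto simp: mult.assoc)
  then show ?thesis
    using assms(2) unfolding mult_units_iff by blast
qed

lemma coef_closed [simp]: "f \<in> T \<Longrightarrow> coef f k \<in> S"
  unfolding laurent_polys_def by simp

lemma laurent_polysI: "(\<And>k. coef f k \<in> S) \<Longrightarrow> f \<in> T"
  unfolding laurent_polys_def by simp

lemma mon_closed: "a \<in> S \<Longrightarrow> mon k a \<in> T"
  by (rule laurent_polysI) (simp add: lookup_single when_def)

text \<open>A coefficient of \<open>p * q\<close> is a sum of elements of \<open>S\<close>, so a
  single nonzero term keeps it nonzero.\<close>

lemma supp_mult:
  assumes "p \<in> T" "q \<in> T" "i \<in> supp p" "j \<in> supp q"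
  shows "i + j \<in> supp (p * q)"
proof (rule ccontr)
  assume "i + j \<notin> supp (p * q)"
  then have "(\<Sum>k\<in>supp p. coef p k * coef q (i + j - k)) = 0"
    by (simp add: in_keys_iff coef_mult)
  then have "coef p i * coef q (i + j - i) = 0"
    by (rule sum_eq_0_imp[rotated 2]) (use assms in auto)
  then show False
    using assms by (auto simp: in_keys_iff)
qed

text \<open>Nonzero terms of the coefficient at \<open>i + j\<close> correspond to representations
  of this exponent, and an atom admits only one nonzero term.\<close>

lemma supp_mult_atom_unique:
  assumes "p \<in> T" "q \<in> T" "i \<in> supp p" "j \<in> supp q" "i' \<in> supp p" "j' \<in> supp q"
    and "i + j = i' + j'" and "coef (p * q) (i + j) \<in> add_atoms S"
  shows "i = i'"
proof (rule add_atom_sum_unique[of "supp p" "\<lambda>k. coef p k * coef q (i + j - k)"])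
  show "(\<Sum>k\<in>supp p. coef p k * coef q (i + j - k)) \<in> add_atoms S"
    using assms(8) by (simp add: coef_mult)
  have "i + j - i' = j'"
    using assms(7) by simp
  then show "coef p i' * coef q (i + j - i') \<noteq> 0"
    using assms(5,6) by (simp add: in_keys_iff)
  show "coef p i * coef q (i + j - i) \<noteq> 0"
    using assms(3,4) by (simp add: in_keys_iff)
qed (use assms in auto)

lemma mon_mult_unit:
  assumes "u \<in> mult_units S"
  shows "mon k u \<in> mult_units T"
proof -
  obtain v where v: "v \<in> S" "u * v = 1" and u: "u \<in> S"
    using assms unfolding mult_units_iff by auto
  have "mon k u * mon (- k) v = 1"
    using v by (simp add: mult_single)
  then show ?thesis
    unfolding mult_units_T_iff using mon_closed[OF u, of k] mon_closed[OF v(1), of "- k"] by blast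
qed

text \<open>For a fixed \<open>j\<close> in the support of the inverse, every exponent of
  \<open>p\<close> must be \<open>- j\<close>, since \<open>1\<close> has support
  \<open>{0}\<close>.\<close>

lemma mult_units_T_cases:
  assumes "p \<in> mult_units T"
  obtains k u where "u \<in> mult_units S" "p = mon k u"
proof -
  obtain q where pq: "p \<in> T" "q \<in> T" "p * q = 1"
    using assms unfolding mult_units_T_iff by auto
  then have "p \<noteq> 0" "q \<noteq> 0" by auto
  then obtain i j where ij: "i \<in> supp p" "j \<in> supp q"
    by (meson keys_eq_empty ex_in_conv equals0I)
  have "k + j = 0" if "k \<in> supp p" for k
    using supp_mult[OF pq(1,2) that ij(2)] pq(3) by simp
  then have "supp p \<subseteq> {- j}" by (auto simp: eq_neg_iff_add_eq_0)
  then have p: "p = mon (- j) (coef p (- j))"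
    by (rule poly_mapping_eq_mon)
  have "coef (p * q) 0 = (\<Sum>i\<in>{- j}. coef p i * coef q (0 - i))"
    unfolding coef_mult
    by (rule sum.mono_neutral_left) (use \<open>supp p \<subseteq> {- j}\<close> in \<open>auto simp: in_keys_iff\<close>)
  then have "coef p (- j) * coef q j = 1"
    using pq by (simp add: lookup_one)
  then have "coef p (- j) \<in> mult_units S"
    unfolding mult_units_iff using pq(1,2) by (meson coef_closed)
  then show ?thesis by (rule that[OF _ p])
qed

text \<open>Every coefficient of the product is a multiple of the only coefficient of
  \<open>p\<close>.\<close>

lemma mon_factor_unit:
  assumes "p \<in> T" "q \<in> T" "supp p \<subseteq> {k}" "coef (p * q) e \<in> mult_units S"
  shows "p \<in> mult_units T"
proof -
  have p: "p = mon k (coef p k)"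
    using assms(3) by (rule poly_mapping_eq_mon)
  have "coef (p * q) e = (\<Sum>i\<in>{k}. coef p i * coef q (e - i))"
    unfolding coef_mult
    by (rule sum.mono_neutral_left) (use assms(3) in \<open>auto simp: in_keys_iff\<close>)
  then have "coef p k \<in> mult_units S"
    using assms mult_unit_factor[of "coef p k" "coef q (e - k)"] by simp
  then show ?thesis
    by (subst p) (rule mon_mult_unit)
qed

end

section \<open>Splitting finite sets of integers\<close>

text \<open>
  If \<open>A = P + Q\<close> with \<open>P\<close> and \<open>Q\<close> not singletons and \<open>e = p + q\<close> is the only representation of
  \<open>e\<close>, then every other \<open>l\<close> is either \<open>x + y - e\<close> with \<open>x\<close>, \<open>y\<close> in \<open>A - {e}\<close> (if both its summands
  differ from \<open>p\<close> and \<open>q\<close>) or satisfies \<open>l + x - e \<in> A - {e}\<close> for some \<open>x\<close> in \<open>A - {e}\<close>. The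
  following condition excludes both.
\<close>

definition indecomposable_at :: "int set \<Rightarrow> int \<Rightarrow> bool" where
  "indecomposable_at A e \<longleftrightarrow> e \<in> A \<and>
     (\<exists>l\<in>A - {e}. (\<forall>x\<in>A - {e}. l + x - e \<notin> A - {e}) \<and>
        (\<forall>x\<in>A - {e}. \<forall>y\<in>A - {e}. x + y - e \<noteq> l))"

lemma indecomposable_at_pair: "a \<noteq> b \<Longrightarrow> indecomposable_at {a, b} a"
  unfolding indecomposable_at_def by auto

text \<open>An arithmetic progression of length 3 is a sumset of two pairs, but then its middle has
  two representations; hence the mark at \<open>b\<close>.\<close>

lemma indecomposable_at_middle:
  assumes "a < b" "b < c"
  shows "indecomposable_at {a, b, c} b"
  unfolding indecomposable_at_def using assms by auto

text \<open>Two distances from \<open>m\<close> add up to more than \<open>M - m\<close>, so any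
  \<open>l\<close> serves as the witness.\<close>

lemma indecomposable_at_bottom:
  assumes "m \<in> A" "l \<in> A" "l \<noteq> m"
    and "\<And>x. x \<in> A \<Longrightarrow> x \<noteq> m \<Longrightarrow> x \<le> M \<and> m + M < 2 * x"
  shows "indecomposable_at A m"
proof -
  have "x + y - m \<notin> A" if "x \<in> A - {m}" "y \<in> A - {m}" for x y
  proof
    assume "x + y - m \<in> A"
    moreover have "m + M < 2 * x" "m + M < 2 * y" "x \<le> M" "y \<le> M" using assms(4) that by auto
    ultimately show False using assms(4)[of "x + y - m"] by auto
  qed
  then show ?thesis
    unfolding indecomposable_at_def using assms(1-3) by blast
qed

text \<open>Here the midpoint is allowed, so two distances from \<open>M\<close> may add up to
  exactly \<open>M - m\<close>. When \<open>m\<close> lies in \<open>A\<close>, taking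
  \<open>l\<close> strictly below the midpoint excludes \<open>l + x - M = m\<close>.\<close>

lemma indecomposable_at_top:
  assumes "M \<in> A" "l \<in> A" "l \<noteq> M" "m < l" "m \<in> A \<Longrightarrow> 2 * l < m + M"
    and "\<And>x. x \<in> A \<Longrightarrow> x \<noteq> M \<Longrightarrow> m \<le> x \<and> 2 * x \<le> m + M"
  shows "indecomposable_at A M"
proof -
  have "l + x - M \<notin> A - {M}" if "x \<in> A - {M}" for x
  proof
    assume *: "l + x - M \<in> A - {M}"
    have "2 * x \<le> m + M" "2 * l \<le> m + M" using assms that by auto
    moreover have "m \<le> l + x - M" using assms(6) * by auto
    ultimately have "l + x - M = m" "2 * l = m + M" by linarith+
    then show False using * assms(5) by auto
  qed
  moreover have "x + y - M \<noteq> l" if "x \<in> A - {M}" "y \<in> A - {M}" for x y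
    using assms(4) assms(6)[of x] assms(6)[of y] that by auto
  ultimately show ?thesis
    unfolding indecomposable_at_def using assms(1-3) by blast
qed

lemma mem_uminus_image: "z \<in> uminus ` A \<longleftrightarrow> - z \<in> A" for z :: "'a::group_add"
  by (metis image_iff minus_minus)

lemma indecomposable_at_uminus:
  assumes "indecomposable_at A e"
  shows "indecomposable_at (uminus ` A) (- e)"
proof -
  obtain l where l: "l \<in> A" "l \<noteq> e" "\<And>x. x \<in> A \<Longrightarrow> x \<noteq> e \<Longrightarrow> l + x - e \<notin> A - {e}"
    "\<And>x y. x \<in> A \<Longrightarrow> x \<noteq> e \<Longrightarrow> y \<in> A \<Longrightarrow> y \<noteq> e \<Longrightarrow> x + y - e \<noteq> l" and e: "e \<in> A"
    using assms unfolding indecomposable_at_def by blast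
  note mem = mem_uminus_image
  show ?thesis
    unfolding indecomposable_at_def Diff_iff Ball_def Bex_def mem
  proof (intro conjI exI[of _ "- l"] allI impI notI)
    fix x assume *: "- x \<in> A \<and> x \<notin> {- e}"
      and "- (- l + x - - e) \<in> A \<and> - l + x - - e \<notin> {- e}"
    then have "l + - x - e \<in> A - {e}" by (auto simp: algebra_simps)
    then show False using l(3)[of "- x"] * by auto
  next
    fix x y assume "- x \<in> A \<and> x \<notin> {- e}" "- y \<in> A \<and> y \<notin> {- e}" "x + y - - e = - l"
    then show False using l(4)[of "- x" "- y"] by auto
  qed (use l e in auto)
qed

text \<open>
  \<open>X\<close> is the support of the polynomial to be split, and \<open>N\<close> consists of the exponents with non-unit
  coefficient. Only these coefficients are sums of two nonzero elements, one of which can be chosen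
  to be a unit; \<open>e\<close> and \<open>e'\<close> mark the exponents at which the two parts receive a unit coefficient.
\<close>

definition splits_indecomposably :: "int set \<Rightarrow> int set \<Rightarrow> bool" where
  "splits_indecomposably X N \<longleftrightarrow>
     (\<exists>A B e e'. A \<union> B = X \<and> A \<inter> B \<subseteq> N \<and> e \<noteq> e' \<and> (e \<in> N \<longrightarrow> e \<in> B) \<and> (e' \<in> N \<longrightarrow> e' \<in> A) \<and>
        indecomposable_at A e \<and> indecomposable_at B e')"

lemma splits_indecomposablyI:
  assumes "indecomposable_at A e" "indecomposable_at B e'" "A \<union> B = X" "A \<inter> B \<subseteq> N" "e \<noteq> e'"
    and "e \<in> N \<Longrightarrow> e \<in> B" "e' \<in> N \<Longrightarrow> e' \<in> A"
  shows "splits_indecomposably X N"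
  unfolding splits_indecomposably_def
  by (intro exI[of _ A] exI[of _ B] exI[of _ e] exI[of _ e'] conjI impI) (fact assms)+

text \<open>Reflection exchanges the two ends of \<open>X\<close>, so an asymmetric case needs
  treatment at one end only.\<close>

lemma splits_indecomposably_uminus:
  assumes "splits_indecomposably (uminus ` X) (uminus ` N)"
  shows "splits_indecomposably X N"
proof -
  obtain A B e e' where *: "A \<union> B = uminus ` X" "A \<inter> B \<subseteq> uminus ` N" "e \<noteq> e'"
    "e \<in> uminus ` N \<Longrightarrow> e \<in> B" "e' \<in> uminus ` N \<Longrightarrow> e' \<in> A"
    "indecomposable_at A e" "indecomposable_at B e'"
    using assms unfolding splits_indecomposably_def by blast
  note mem = mem_uminus_image
  show ?thesis
  proof (rule splits_indecomposablyI[of _ "- e" _ "- e'"])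
    show "uminus ` A \<union> uminus ` B = X"
      unfolding image_Un[symmetric] *(1) image_image by simp
    show "uminus ` A \<inter> uminus ` B \<subseteq> N"
      using *(2) by (auto simp: mem subset_iff)
  qed (use * in \<open>auto simp: mem indecomposable_at_uminus\<close>)
qed

section \<open>Splittings according to which ends of the support lie in \<open>N\<close>\<close>

lemma splits_both_ends:
  assumes bd: "\<And>x. x \<in> X \<Longrightarrow> m \<le> x \<and> x \<le> M" and "m \<in> N" "M \<in> N" "N \<subseteq> X"
    and i: "i \<in> X" "m < i" "2 * i < m + M"
  shows "splits_indecomposably X N"
proof (rule splits_indecomposablyI)
  \<comment> \<open>Both ends are shared. Since \<open>m\<close> lies in \<open>?B\<close>, the
    witness for \<open>?B\<close> has to be strictly below the midpoint, as \<open>i\<close>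
    is.\<close>
  let ?A = "{x \<in> X. x = m \<or> m + M < 2 * x}" and ?B = "{x \<in> X. x = M \<or> 2 * x \<le> m + M}"
  have ends: "m \<in> X" "M \<in> X" "m < M"
    using assms by auto
  show "indecomposable_at ?A m"
    by (rule indecomposable_at_bottom[where l = M and M = M]) (use ends bd in auto)
  show "indecomposable_at ?B M"
    by (rule indecomposable_at_top[where l = i and m = m]) (use ends bd i in auto)
  show "?A \<inter> ?B \<subseteq> N" "?A \<union> ?B = X" "m \<noteq> M" "m \<in> ?B" "M \<in> ?A"
    using assms ends by auto
qed

lemma splits_top:
  assumes bd: "\<And>x. x \<in> X \<Longrightarrow> m \<le> x \<and> x \<le> M" and "m \<in> X" "m \<notin> N" "M \<in> N" "N \<subseteq> X"
    and i: "i \<in> X" "m < i" "i < M"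
  shows "splits_indecomposably X N"
proof (cases "\<exists>j\<in>X. m < j \<and> 2 * j \<le> m + M")
  case True
  then obtain j where j: "j \<in> X" "m < j" "2 * j \<le> m + M" by blast
  \<comment> \<open>The exponent \<open>m\<close> cannot be shared and is left out of
    \<open>?B\<close>, so the witness \<open>j\<close> may be the midpoint itself.\<close>
  let ?A = "{x \<in> X. x = m \<or> m + M < 2 * x}" and ?B = "{x \<in> X. x = M \<or> x \<noteq> m \<and> 2 * x \<le> m + M}"
  have ends: "M \<in> X" "m < M"
    using assms by auto
  show ?thesis
  proof (rule splits_indecomposablyI)
    show "indecomposable_at ?A m"
      by (rule indecomposable_at_bottom[where l = M and M = M]) (use assms(2) ends bd in auto)
    show "indecomposable_at ?B M"
      by (rule indecomposable_at_top[where l = j and m = m]) (use ends bd j in auto)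
    show "?A \<inter> ?B \<subseteq> N" "?A \<union> ?B = X" "m \<noteq> M" "m \<in> N \<Longrightarrow> m \<in> ?B" "M \<in> ?A"
      using assms ends by auto
  qed
next
  \<comment> \<open>Now every exponent other than \<open>m\<close> exceeds the midpoint, so
    \<open>X - {i}\<close> is of the first kind and a pair takes care of \<open>i\<close>.\<close>
  case False
  have ends: "M \<in> X" "m < M"
    using assms by auto
  show ?thesis
  proof (rule splits_indecomposablyI)
    show "indecomposable_at (X - {i}) m"
      by (rule indecomposable_at_bottom[where l = M and M = M])
        (use assms(2) ends bd i False in \<open>force+\<close>)
    show "indecomposable_at {M, i} M"
      using i by (intro indecomposable_at_pair) auto
    show "(X - {i}) \<inter> {M, i} \<subseteq> N" "(X - {i}) \<union> {M, i} = X" "m \<noteq> M"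
      "m \<in> N \<Longrightarrow> m \<in> {M, i}" "M \<in> X - {i}"
      using assms ends by auto
  qed
qed

lemma splits_no_ends:
  assumes bd: "\<And>x. x \<in> X \<Longrightarrow> m \<le> x \<and> x \<le> M" and ends: "m \<in> X" "M \<in> X" "m < M" "m \<notin> N" "M \<notin> N"
    and i: "i \<in> X" "m < i" "i < M" and N: "X = {m, i, M} \<Longrightarrow> i \<in> N"
  shows "splits_indecomposably X N"
proof -
  let ?L = "{x \<in> X. m < x \<and> 2 * x \<le> m + M}" and ?R = "{x \<in> X. m + M < 2 * x \<and> x < M}"
  let ?J = "X - {m, i, M}"
  \<comment> \<open>If the interior exponents lie on one side only, one part is an end with
    \<open>i\<close> and the other is the opposite end with \<open>J\<close>. A sole interior
    exponent \<open>i\<close> is shared, which the last premise permits.\<close>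
  define J where "J = (if ?J = {} then {i} else ?J)"
  have J: "J \<noteq> {}" "J \<subseteq> X - {m, M}" "insert i J = X - {m, M}" "J \<inter> {i} \<subseteq> N"
    unfolding J_def using i N ends by auto
  then obtain j where j: "j \<in> J" by blast
  consider l r where "l \<in> ?L" "r \<in> ?R" | "?R = {}" | "?L = {}" by blast
  then show ?thesis
  proof cases
    case 1
    show ?thesis
    proof (rule splits_indecomposablyI)
      show "indecomposable_at (insert m ?R) m"
        by (rule indecomposable_at_bottom[where l = r and M = M]) (use 1 ends bd in auto)
      show "indecomposable_at (insert M ?L) M"
        by (rule indecomposable_at_top[where l = l and m = m]) (use 1 ends bd in auto)
      show "insert m ?R \<union> insert M ?L = X"
        using bd ends by force
    qed (use ends in auto)
  next
    case 2
    have low: "2 * x \<le> m + M" if "x \<in> X" "x \<noteq> M" for x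
      using 2 bd[OF that(1)] that by force
    show ?thesis
    proof (rule splits_indecomposablyI)
      show "indecomposable_at {m, i} m"
        using i by (intro indecomposable_at_pair) auto
      show "indecomposable_at (insert M J) M"
        by (rule indecomposable_at_top[where l = j and m = m]) (use ends bd j J low in force)+
    qed (use J ends i in auto)
  next
    case 3
    have high: "m + M < 2 * x" if "x \<in> X" "x \<noteq> m" for x
      using 3 bd[OF that(1)] that by force
    show ?thesis
    proof (rule splits_indecomposablyI)
      show "indecomposable_at (insert m J) m"
        by (rule indecomposable_at_bottom[where l = j and M = M]) (use ends bd j J high in force)+
      show "indecomposable_at {M, i} M"
        using i by (intro indecomposable_at_pair) auto
    qed (use J ends i in auto)
  qed
qed

text \<open>The conditions on cardinalities 2 and 3 reflect the exclusion of the forms (a) and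
  (b).\<close>

lemma splits_indecomposably:
  assumes "finite X" "card X > 1" "N \<subseteq> X"
    and two: "card X = 2 \<Longrightarrow> N = X" and three: "card X = 3 \<Longrightarrow> N \<noteq> {}"
  shows "splits_indecomposably X N"
proof -
  define m M where "m = Min X" and "M = Max X"
  have "X \<noteq> {}" using assms by auto
  have ends: "m \<in> X" "M \<in> X" and bd: "\<And>x. x \<in> X \<Longrightarrow> m \<le> x \<and> x \<le> M"
    unfolding m_def M_def using assms(1) \<open>X \<noteq> {}\<close> by auto
  obtain y where "y \<in> X" "y \<noteq> m"
    using card_gt_1_obtain[OF assms(2)] by blast
  then have "m < M" using bd[of y] by auto
  have neg: "\<And>x. x \<in> uminus ` X \<Longrightarrow> - M \<le> x \<and> x \<le> - m"
    using bd by auto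
  show ?thesis
  proof (cases "X = {m, M}")
    case True
    then have "N = X" using two \<open>m < M\<close> by simp
    show ?thesis
      by (rule splits_indecomposablyI[of "{m, M}" m "{M, m}" M])
        (use \<open>N = X\<close> True \<open>m < M\<close> indecomposable_at_pair in auto)
  next
    case False
    then obtain i where "i \<in> X" "i \<noteq> m" "i \<noteq> M"
      using ends by blast
    then have i: "i \<in> X" "m < i" "i < M"
      using bd[of i] by auto
    have N3: "i \<in> N" if "X = {m, i, M}" "m \<notin> N" "M \<notin> N"
    proof -
      have "card X = 3" using that(1) i by (simp add: card_insert_if)
      then show ?thesis using three \<open>N \<subseteq> X\<close> that by auto
    qed
    consider "m \<notin> N" "M \<notin> N" | "m \<notin> N" "M \<in> N" | "m \<in> N" "M \<notin> N" | "m \<in> N" "M \<in> N"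
      by blast
    then show ?thesis
    proof cases
      case 1
      show ?thesis
        by (rule splits_no_ends[of X m M N i]) (use 1 bd ends \<open>m < M\<close> i N3 in auto)
    next
      case 2
      show ?thesis
        by (rule splits_top[of X m M N i]) (use 2 bd ends i \<open>N \<subseteq> X\<close> in auto)
    next
      case 3
      have "splits_indecomposably (uminus ` X) (uminus ` N)"
        by (rule splits_top[of _ "- M" "- m" _ "- i"]) (use 3 neg ends i \<open>N \<subseteq> X\<close> in auto)
      then show ?thesis by (rule splits_indecomposably_uminus)
    next
      case 4
      \<comment> \<open>Unless some interior exponent lies off the midpoint, the support is an
        arithmetic progression of length 3.\<close>
      consider j where "j \<in> X" "m < j" "2 * j < m + M" | j where "j \<in> X" "j < M" "m + M < 2 * j"
        | "X = {m, i, M}" "2 * i = m + M"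
      proof -
        assume a: "\<And>j. j \<in> X \<Longrightarrow> m < j \<Longrightarrow> 2 * j < m + M \<Longrightarrow> thesis"
          "\<And>j. j \<in> X \<Longrightarrow> j < M \<Longrightarrow> m + M < 2 * j \<Longrightarrow> thesis"
          "X = {m, i, M} \<Longrightarrow> 2 * i = m + M \<Longrightarrow> thesis"
        show thesis
        proof (rule ccontr)
          assume no: "\<not> thesis"
          have mid: "2 * j = m + M" if "j \<in> X" "j \<noteq> m" "j \<noteq> M" for j
            using a(1,2)[of j] no bd[of j] that by linarith
          have "X \<subseteq> {m, i, M}"
          proof
            fix j assume "j \<in> X"
            then show "j \<in> {m, i, M}"
              using mid[of i] mid[of j] i by auto
          qed
          then show False
            using a(3) no ends i mid[of i] by auto
        qed
      qed
      then show ?thesis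
      proof cases
        case 1
        then show ?thesis
          by (intro splits_both_ends[of X m M N j]) (use 4 bd \<open>N \<subseteq> X\<close> in auto)
      next
        case 2
        have "splits_indecomposably (uminus ` X) (uminus ` N)"
          by (rule splits_both_ends[of _ "- M" "- m" _ "- j"]) (use 2 4 neg \<open>N \<subseteq> X\<close> in auto)
        then show ?thesis by (rule splits_indecomposably_uminus)
      next
        case 3
        \<comment> \<open>The first part is all of \<open>X\<close>, marked at \<open>i\<close>. If
          \<open>i\<close> is in \<open>N\<close>, its coefficient must be split to yield a unit, so
          the second part contains \<open>i\<close> as well; otherwise \<open>i\<close> cannot be
          shared, and \<open>M\<close> is taken instead.\<close>
        define y where "y = (if i \<in> N then i else M)"
        show ?thesis
        proof (rule splits_indecomposablyI)
          show "indecomposable_at {m, i, M} i"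
            using i by (intro indecomposable_at_middle)
          show "indecomposable_at {m, y} m"
            using i unfolding y_def by (intro indecomposable_at_pair) auto
        qed (use 3 4 i in \<open>auto simp: y_def split: if_splits\<close>)
      qed
    qed
  qed
qed

section \<open>Sums of two irreducibles\<close>

context reduced_semidomain
begin

lemma unit_coef_irreducible:
  assumes units: "mult_units S \<subseteq> add_atoms S"
    and g: "g \<in> T" and e: "coef g e \<in> mult_units S" and ind: "indecomposable_at (supp g) e"
  shows "g \<in> mult_irreducibles T"
proof -
  obtain l where l: "l \<in> supp g" "l \<noteq> e"
    and l1: "\<forall>x\<in>supp g - {e}. l + x - e \<notin> supp g - {e}"
    and l2: "\<forall>x\<in>supp g - {e}. \<forall>y\<in>supp g - {e}. x + y - e \<noteq> l"
    and esupp: "e \<in> supp g"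
    using ind unfolding indecomposable_at_def by blast
  have "g \<notin> mult_units T"
  proof
    assume "g \<in> mult_units T"
    then obtain k u where "g = mon k u" by (rule mult_units_T_cases)
    then show False using l esupp by (auto split: if_splits)
  qed
  moreover have "p \<in> mult_units T \<or> q \<in> mult_units T" if pq: "p \<in> T" "q \<in> T" "g = p * q" for p q
  proof (rule ccontr)
    assume no: "\<not> ?thesis"
    \<comment> \<open>A factor with at most one exponent would be a unit by
      \<open>mon_factor_unit\<close>.\<close>
    have p1: "\<not> supp p \<subseteq> {k}" and q1: "\<not> supp q \<subseteq> {k}" for k
      using mon_factor_unit[OF pq(1,2), of k e] mon_factor_unit[OF pq(2,1), of k e] pq(3) e no
      by (auto simp: mult.commute)
    have split: "\<exists>i\<in>supp p. \<exists>j\<in>supp q. k = i + j" if "k \<in> supp g" for k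
      using that keys_mult[of p q] unfolding pq(3) by blast
    obtain i0 j0 where 0: "i0 \<in> supp p" "j0 \<in> supp q" "e = i0 + j0"
      using split[OF esupp] by blast
    \<comment> \<open>The coefficient at \<open>e\<close> is an atom, so no second pair of exponents
      sums to \<open>e\<close>.\<close>
    have other: "i + j \<in> supp g - {e}" if "i \<in> supp p" "j \<in> supp q" "i \<noteq> i0 \<or> j \<noteq> j0" for i j
    proof -
      have "i + j \<noteq> e"
      proof
        assume ije: "i + j = e"
        then have "i = i0"
          using supp_mult_atom_unique[OF pq(1,2) that(1,2) 0(1,2)] 0(3) e units pq(3) by blast
        then show False using ije 0(3) that(3) by simp
      qed
      then show ?thesis
        using supp_mult[OF pq(1,2) that(1,2)] pq(3) by simp
    qed
    obtain i j where ij: "i \<in> supp p" "j \<in> supp q" "l = i + j"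
      using split[OF l(1)] by blast
    consider "i \<noteq> i0" "j \<noteq> j0" | "i = i0" "j \<noteq> j0" | "i \<noteq> i0" "j = j0"
      using ij(3) l(2) 0(3) by blast
    then show False
    proof cases
      case 1
      \<comment> \<open>Exchanging summands between \<open>l = i + j\<close> and
        \<open>e = i0 + j0\<close> gives two exponents other than \<open>e\<close>, contradicting
        \<open>l2\<close>.\<close>
      have "i + j0 + (i0 + j) - e = l" using 0 ij by simp
      then show False
        using l2 other[of i j0] other[of i0 j] ij 0 1 by blast
    next
      case 2
      \<comment> \<open>Replacing \<open>i0\<close> by another exponent \<open>i1\<close> of
        \<open>p\<close> shifts both \<open>e\<close> and \<open>l\<close> within the support by the
        same amount, contradicting \<open>l1\<close>.\<close>
      obtain i1 where i1: "i1 \<in> supp p" "i1 \<noteq> i0" using p1[of i0] by blast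
      have "l + (i1 + j0) - e = i1 + j" using 0 ij 2 by simp
      then show False
        using l1 other[of i1 j0] other[of i1 j] ij 0 i1 by metis
    next
      case 3
      obtain j1 where j1: "j1 \<in> supp q" "j1 \<noteq> j0" using q1[of j0] by blast
      have "l + (i0 + j1) - e = i + j1" using 0 ij 3 by simp
      then show False
        using l1 other[of i0 j1] other[of i j1] ij 0 j1 by metis
    qed
  qed
  moreover have "g \<noteq> 0" using l by auto
  ultimately show ?thesis
    unfolding mult_irreducibles_def using g by blast
qed

section \<open>Additive atoms versus multiplicative units\<close>

lemma units_eq_add_atomsI:
  assumes atomic: "additively_atomic S" and le: "add_atoms S \<subseteq> mult_units S"
  shows "add_atoms S = mult_units S"
proof (rule equalityI[OF le], rule subsetI)
  fix v assume "v \<in> mult_units S"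
  then obtain w where v: "v \<in> S" and w: "w \<in> S" "v * w = 1"
    unfolding mult_units_iff by blast
  \<comment> \<open>Since \<open>1\<close> is nonzero, its decomposition supplies an atom
    \<open>u\<close>.\<close>
  obtain as where as: "set as \<subseteq> add_atoms S" "sum_list as = (1::'a)"
    using atomic unfolding additively_atomic_def by force
  then obtain u where u: "u \<in> add_atoms S"
    by (cases as) auto
  then have "u \<in> S" unfolding add_atoms_def by simp
  have "b = 0 \<or> c = 0" if "b \<in> S" "c \<in> S" "v = b + c" for b c
  proof -
    \<comment> \<open>Multiplication by \<open>u * w\<close> carries a decomposition of
      \<open>v\<close> to one of the atom \<open>u\<close>.\<close>
    have "u * w * b + u * w * c = u"
      using w(2) by (simp add: mult.commute[of v] mult.assoc that(3)[symmetric] flip: distrib_left)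
    then have "u * w * b = 0 \<or> u * w * c = 0"
      using add_atom_add[of "u * w * b" "u * w * c"] u that \<open>u \<in> S\<close> w by auto
    moreover have "w \<noteq> 0" "u \<noteq> 0"
      using w(2) u unfolding add_atoms_def by auto
    ultimately show ?thesis by simp
  qed
  moreover have "v \<noteq> 0" using w(2) by auto
  ultimately show "v \<in> add_atoms S"
    unfolding add_atoms_def using v by auto
qed

text \<open>The first atom in a decomposition of \<open>a\<close> is a unit, and the rest is nonzero
  because \<open>a\<close> itself is not a unit.\<close>

lemma unit_plus_nonzero:
  assumes atomic: "additively_atomic S" and eq: "add_atoms S = mult_units S"
    and a: "a \<in> S" "a \<noteq> 0" "a \<notin> mult_units S"
  obtains u r where "u \<in> mult_units S" "r \<in> S" "r \<noteq> 0" "a = u + r"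
proof -
  obtain as where as: "set as \<subseteq> add_atoms S" "sum_list as = a"
    using atomic a unfolding additively_atomic_def by force
  have closed: "sum_list bs \<in> S" if "set bs \<subseteq> add_atoms S" for bs
    using that by (induction bs) (auto simp: add_atoms_def)
  obtain u bs where bs: "as = u # bs"
    using as a by (cases as) auto
  show ?thesis
    by (rule that[of u "sum_list bs"]) (use as bs closed[of bs] eq a in auto)
qed

lemma poly_mapping_of_fun:
  assumes "finite {k. t k \<noteq> 0}"
  obtains g where "coef g = t" "supp g = {k. t k \<noteq> 0}"
  using lookup_Abs_poly_mapping[OF assms] that[of "Abs_poly_mapping t"]
  by (simp add: keys.rep_eq)

text \<open>Coefficients at shared exponents are split by \<open>unit_plus_nonzero\<close>; all
  others go unchanged to one part.\<close>

lemma sum_of_two_irreducibles: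
  assumes atomic: "additively_atomic S" and eq: "add_atoms S = mult_units S"
    and f: "f \<in> T"
    and split: "splits_indecomposably (supp f) {k \<in> supp f. coef f k \<notin> mult_units S}"
  shows "\<exists>g\<in>mult_irreducibles T. \<exists>h\<in>mult_irreducibles T. f = g + h"
proof -
  let ?N = "{k \<in> supp f. coef f k \<notin> mult_units S}"
  obtain A B e e' where AB: "A \<union> B = supp f" "A \<inter> B \<subseteq> ?N" "e \<noteq> e'"
    and e: "e \<in> ?N \<longrightarrow> e \<in> B" "e' \<in> ?N \<longrightarrow> e' \<in> A"
    and ind: "indecomposable_at A e" "indecomposable_at B e'"
    using split unfolding splits_indecomposably_def by blast
  have eA: "e \<in> A" "e' \<in> B"
    using ind unfolding indecomposable_at_def by auto
  \<comment> \<open>Here \<open>x\<close> goes to \<open>g\<close> and \<open>y\<close> to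
    \<open>h\<close>. The unit summand goes to \<open>h\<close> at \<open>e'\<close> and to
    \<open>g\<close> elsewhere, in particular at \<open>e\<close>, because \<open>e\<close> and
    \<open>e'\<close> differ.\<close>
  define splits where "splits k x y \<longleftrightarrow> x \<in> S - {0} \<and> y \<in> S - {0} \<and> coef f k = x + y \<and>
    (if k = e' then y else x) \<in> mult_units S" for k x y
  have "\<exists>x y. splits k x y" if "k \<in> ?N" for k
  proof -
    have "coef f k \<in> S" "coef f k \<noteq> 0" "coef f k \<notin> mult_units S"
      using f that by (auto simp: in_keys_iff)
    then obtain u r where ur: "u \<in> mult_units S" "r \<in> S" "r \<noteq> 0" "coef f k = u + r"
      by (rule unit_plus_nonzero[OF atomic eq])
    have u: "u \<in> S - {0}"
      using ur(1) unfolding mult_units_def by blast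
    have ru: "coef f k = r + u"
      unfolding ur(4) by (rule add.commute)
    show ?thesis
    proof (cases "k = e'")
      case True
      then have "splits k r u"
        using ur(1-3) u ru by (simp add: splits_def)
      then show ?thesis by blast
    next
      case False
      then have "splits k u r"
        using ur u by (simp add: splits_def)
      then show ?thesis by blast
    qed
  qed
  then have "\<forall>k\<in>?N. \<exists>x. \<exists>y. splits k x y" by blast
  from bchoice[OF this] obtain x where "\<forall>k\<in>?N. \<exists>y. splits k (x k) y" by blast
  from bchoice[OF this] obtain y where xy: "\<forall>k\<in>?N. splits k (x k) (y k)" by blast
  have both: "splits k (x k) (y k)" if "k \<in> A" "k \<in> B" for k
    using xy that AB(2) by blast
  define s where "s k = (if k \<in> A then if k \<in> B then x k else coef f k else 0)" for k
  define t where "t k = (if k \<in> B then if k \<in> A then y k else coef f k else 0)" for k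
  have nz: "coef f k \<noteq> 0 \<longleftrightarrow> k \<in> A \<or> k \<in> B" for k
    unfolding in_keys_iff[symmetric] AB(1)[symmetric] by simp
  have st: "(s k \<noteq> 0 \<longleftrightarrow> k \<in> A) \<and> (t k \<noteq> 0 \<longleftrightarrow> k \<in> B) \<and> coef f k = s k + t k \<and> s k \<in> S \<and> t k \<in> S" for k
    using both[of k] nz[of k] coef_closed[OF f, of k]
    by (cases "k \<in> A"; cases "k \<in> B") (simp_all add: s_def t_def splits_def)
  have AB_eq: "{k. s k \<noteq> 0} = A" "{k. t k \<noteq> 0} = B"
    using st by simp_all
  have fin: "finite A" "finite B"
    using finite_keys[of f] unfolding AB(1)[symmetric] by simp_all
  obtain g where g: "coef g = s" "supp g = A"
    using poly_mapping_of_fun[of s] fin AB_eq by auto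
  obtain h where h: "coef h = t" "supp h = B"
    using poly_mapping_of_fun[of t] fin AB_eq by auto
  have "f = g + h"
  proof (rule poly_mapping_eqI)
    fix k
    have "coef f k = s k + t k" using st[of k] by blast
    then show "coef f k = coef (g + h) k" unfolding lookup_add g(1) h(1) .
  qed
  have T: "g \<in> T" "h \<in> T"
    using st by (auto intro: laurent_polysI simp: g(1) h(1))
  have "coef g e \<in> mult_units S"
  proof (cases "e \<in> B")
    case True
    then show ?thesis using both[of e] AB(3) eA by (simp add: g s_def splits_def)
  next
    case False
    then have "coef f e \<in> mult_units S" using e(1) eA AB(1) by blast
    then show ?thesis using False eA by (simp add: g s_def)
  qed
  then have "g \<in> mult_irreducibles T"
    using unit_coef_irreducible[of g e] T(1) eq g(2) ind(1) by simp
  have "coef h e' \<in> mult_units S"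
  proof (cases "e' \<in> A")
    case True
    then show ?thesis using both[of e'] eA by (simp add: h t_def splits_def)
  next
    case False
    then have "coef f e' \<in> mult_units S" using e(2) eA AB(1) by blast
    then show ?thesis using False eA by (simp add: h t_def)
  qed
  then have "h \<in> mult_irreducibles T"
    using unit_coef_irreducible[of h e'] T(2) eq h(2) ind(2) by simp
  show ?thesis
    using \<open>f = g + h\<close> \<open>g \<in> mult_irreducibles T\<close> \<open>h \<in> mult_irreducibles T\<close> by blast
qed

section \<open>The two exceptional forms and the bound of two summands\<close>

lemma binomial_irreducible:
  assumes units: "mult_units S \<subseteq> add_atoms S" and f: "f \<in> T"
    and b: "binomial_with_unit_coeff S f"
  shows "f \<in> mult_irreducibles T"
proof -
  obtain a b k0 k1 where *: "a \<noteq> 0" "b \<noteq> 0" "k0 \<noteq> k1" "a \<in> mult_units S \<or> b \<in> mult_units S"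
    "f = mon k0 a + mon k1 b"
    using b unfolding binomial_with_unit_coeff_def by blast
  have supp: "supp f = {k0, k1}"
    using *(1-3) unfolding *(5)
    by (auto simp: in_keys_iff lookup_add lookup_single when_def split: if_splits)
  have "coef f k0 = a" "coef f k1 = b"
    using *(3) unfolding *(5) by (auto simp: lookup_add lookup_single)
  moreover have "indecomposable_at (supp f) k0" "indecomposable_at (supp f) k1"
    using indecomposable_at_pair[OF *(3)] indecomposable_at_pair[OF *(3)[symmetric]]
    unfolding supp by (simp_all add: insert_commute)
  ultimately show ?thesis
    using unit_coef_irreducible[OF units f] *(4) by blast
qed

text \<open>As all three coefficients are units, the middle exponent can be marked, whichever it
  is.\<close>

lemma trinomial_irreducible:
  assumes units: "mult_units S \<subseteq> add_atoms S" and f: "f \<in> T"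
    and b: "trinomial_with_unit_coeffs S f"
  shows "f \<in> mult_irreducibles T"
proof -
  obtain a b c k0 k1 k2 where *: "a \<in> mult_units S" "b \<in> mult_units S" "c \<in> mult_units S"
    "k0 \<noteq> k1" "k0 \<noteq> k2" "k1 \<noteq> k2" "f = mon k0 a + mon k1 b + mon k2 c"
    using b unfolding trinomial_with_unit_coeffs_def by blast
  have nz: "a \<noteq> 0" "b \<noteq> 0" "c \<noteq> 0"
    using *(1-3) unfolding mult_units_def by auto
  have supp: "supp f = {k0, k1, k2}"
    using *(4-6) nz unfolding *(7)
    by (auto simp: in_keys_iff lookup_add lookup_single when_def split: if_splits)
  have "coef f k0 = a" "coef f k1 = b" "coef f k2 = c"
    using *(4-6) unfolding *(7) by (auto simp: lookup_add lookup_single)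
  then have coefs: "coef f k \<in> mult_units S" if "k \<in> supp f" for k
    using that *(1-3) supp by auto
  have "\<exists>k\<in>{k0, k1, k2}. indecomposable_at {k0, k1, k2} k"
  proof -
    consider "k0 < k1" "k1 < k2" | "k0 < k2" "k2 < k1" | "k1 < k0" "k0 < k2"
      | "k1 < k2" "k2 < k0" | "k2 < k0" "k0 < k1" | "k2 < k1" "k1 < k0"
      using *(4-6) by linarith
    then show ?thesis
      by cases (auto dest: indecomposable_at_middle simp: insert_commute)
  qed
  then obtain k where "k \<in> supp f" "indecomposable_at (supp f) k"
    unfolding supp by blast
  then show ?thesis
    using unit_coef_irreducible[OF units f coefs] by blast
qed

lemma generic_sum_of_two_irreducibles:
  assumes atomic: "additively_atomic S" and eq: "add_atoms S = mult_units S"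
    and f: "f \<in> T" "card (supp f) > 1"
    and bi: "\<not> binomial_with_unit_coeff S f" and tri: "\<not> trinomial_with_unit_coeffs S f"
  shows "\<exists>g\<in>mult_irreducibles T. \<exists>h\<in>mult_irreducibles T. f = g + h"
proof (rule sum_of_two_irreducibles[OF atomic eq f(1)])
  let ?N = "{k \<in> supp f. coef f k \<notin> mult_units S}"
  show "splits_indecomposably (supp f) ?N"
  proof (rule splits_indecomposably)
    assume "card (supp f) = 2"
    then obtain k0 k1 where k: "supp f = {k0, k1}" "k0 \<noteq> k1"
      by (auto simp: card_2_iff)
    show "?N = supp f"
    proof (rule ccontr)
      assume "?N \<noteq> supp f"
      then have "coef f k0 \<in> mult_units S \<or> coef f k1 \<in> mult_units S"
        using k by auto
      moreover have "coef f k0 \<in> S - {0}" "coef f k1 \<in> S - {0}"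
        using f k by (auto simp flip: in_keys_iff)
      ultimately show False
        using bi k(2) poly_mapping_eq_mon_add_mon[OF k] unfolding binomial_with_unit_coeff_def
        by blast
    qed
  next
    assume "card (supp f) = 3"
    then obtain k0 k1 k2 where k: "supp f = {k0, k1, k2}" "k0 \<noteq> k1" "k0 \<noteq> k2" "k1 \<noteq> k2"
      by (auto simp: card_3_iff)
    show "?N \<noteq> {}"
    proof
      assume "?N = {}"
      then have "coef f k0 \<in> mult_units S" "coef f k1 \<in> mult_units S" "coef f k2 \<in> mult_units S"
        using k by auto
      then show False
        using tri k(2-4) poly_mapping_eq_mon_add_mon_add_mon[OF k]
        unfolding trinomial_with_unit_coeffs_def by blast
    qed
  qed (use f in auto)
qed

lemma laurent_goldbach_2I:
  assumes atomic: "additively_atomic S" and eq: "add_atoms S = mult_units S"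
  shows "laurent_goldbach 2 S"
  unfolding laurent_goldbach_def
proof (intro ballI impI)
  fix f assume f: "f \<in> T" "card (supp f) > 1"
  show "sum_of_at_most_irreducibles 2 T f"
  proof (cases "binomial_with_unit_coeff S f \<or> trinomial_with_unit_coeffs S f")
    case True
    then have "f \<in> mult_irreducibles T"
      using binomial_irreducible trinomial_irreducible eq f(1) by blast
    then show ?thesis
      unfolding sum_of_at_most_irreducibles_def by (intro exI[of _ "[f]"]) auto
  next
    case False
    then obtain g h where "g \<in> mult_irreducibles T" "h \<in> mult_irreducibles T" "f = g + h"
      using generic_sum_of_two_irreducibles[OF atomic eq f] by blast
    then show ?thesis
      unfolding sum_of_at_most_irreducibles_def by (intro exI[of _ "[g, h]"]) auto
  qed
qed

section \<open>From a bound on the number of summands to atoms being units\<close>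

lemma sum_list_T_closed: "set gs \<subseteq> T \<Longrightarrow> sum_list gs \<in> T"
  by (induction gs) (auto intro!: laurent_polysI simp: lookup_add)

text \<open>Here \<open>g\<close> is \<open>a\<close> times a polynomial \<open>p\<close> with
  coefficients 0 and 1. Since \<open>a\<close> is not a unit, irreducibility makes \<open>p\<close>
  a unit, hence a monomial.\<close>

lemma irreducible_atom_coefs_mon:
  assumes a: "a \<in> S" "a \<notin> mult_units S" and g: "g \<in> mult_irreducibles T"
    and coefs: "\<And>k. coef g k \<in> {0, a}"
  shows "card (supp g) \<le> 1"
proof -
  have "finite {k. (if k \<in> supp g then 1::'a else 0) \<noteq> 0}" by simp
  then obtain p :: "int \<Rightarrow>\<^sub>0 'a" where p: "coef p = (\<lambda>k. if k \<in> supp g then 1 else 0)"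
    "supp p = {k. (if k \<in> supp g then 1::'a else 0) \<noteq> 0}"
    by (rule poly_mapping_of_fun)
  have "a \<noteq> 0"
  proof
    assume "a = 0"
    then have "g = 0" using coefs by (intro poly_mapping_eqI) simp
    then show False using g unfolding mult_irreducibles_def by simp
  qed
  have "g = mon 0 a * p"
  proof (rule poly_mapping_eqI)
    fix k
    show "coef g k = coef (mon 0 a * p) k"
      using \<open>a \<noteq> 0\<close> coefs[of k] by (auto simp: coef_mult p in_keys_iff)
  qed
  moreover have "p \<in> T" "mon 0 a \<in> T"
    using a mon_closed by (auto intro: laurent_polysI simp: p)
  ultimately have "mon 0 a \<in> mult_units T \<or> p \<in> mult_units T"
    using g unfolding mult_irreducibles_def by blast
  moreover have "mon 0 a \<notin> mult_units T"
  proof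
    assume "mon 0 a \<in> mult_units T"
    then obtain k u where u: "u \<in> mult_units S" "mon (0::int) a = mon k u"
      by (rule mult_units_T_cases)
    then have "coef (mon k u) 0 = a" by (simp flip: u(2))
    then have "u = a" using \<open>a \<noteq> 0\<close> by (simp add: lookup_single when_def split: if_splits)
    then show False using u a by simp
  qed
  ultimately obtain k u where "p = mon k u"
    using mult_units_T_cases by blast
  moreover have "supp g = supp p" using p(2) by simp
  ultimately show ?thesis by simp
qed

lemma add_atom_is_unit:
  assumes gb: "laurent_goldbach k S" and a: "a \<in> add_atoms S" and "k > 0"
  shows "a \<in> mult_units S"
proof (rule ccontr)
  assume nu: "a \<notin> mult_units S"
  have aS: "a \<in> S" "a \<noteq> 0" using a unfolding add_atoms_def by auto
  \<comment> \<open>The test polynomial has \<open>k + 1\<close> exponents, one more than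
    \<open>k\<close> monomials can cover, and \<open>k > 0\<close> brings it within the scope of
    \<open>laurent_goldbach\<close>.\<close>
  have "finite {i. (if i \<in> {0..int k} then a else 0) \<noteq> 0}"
    by (rule finite_subset[of _ "{0..int k}"]) auto
  then obtain f where f: "coef f = (\<lambda>i. if i \<in> {0..int k} then a else 0)"
    "supp f = {i. (if i \<in> {0..int k} then a else 0) \<noteq> 0}"
    by (rule poly_mapping_of_fun)
  have "{i. (if i \<in> {0..int k} then a else 0) \<noteq> 0} = {0..int k}"
    using aS by auto
  then have card: "card (supp f) = k + 1" by (simp add: f(2))
  have "f \<in> T" using aS by (intro laurent_polysI) (simp add: f(1))
  then have "sum_of_at_most_irreducibles k T f"
    using gb card \<open>k > 0\<close> unfolding laurent_goldbach_def by simp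
  then obtain gs where gs: "length gs \<le> k" "set gs \<subseteq> mult_irreducibles T" "sum_list gs = f"
    unfolding sum_of_at_most_irreducibles_def by blast
  have gsT: "set gs \<subseteq> T" using gs(2) unfolding mult_irreducibles_def by blast
  have one: "card (supp g) \<le> 1" if g: "g \<in> set gs" for g
  proof (rule irreducible_atom_coefs_mon[OF aS(1) nu])
    show "g \<in> mult_irreducibles T" using g gs by blast
    fix i
    \<comment> \<open>The coefficients of \<open>g\<close> and of the remaining sum
      \<open>?r\<close> add up to \<open>a\<close> or 0, and both values decompose only trivially in
      \<open>S\<close>.\<close>
    let ?r = "sum_list (remove1 g gs)"
    have "f = g + ?r" using gs(3) g by (simp add: sum_list_map_remove1[of g gs "\<lambda>x. x", simplified])
    then have sum: "coef f i = coef g i + coef ?r i" by (simp add: lookup_add)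
    have "?r \<in> T" "g \<in> T"
      using gsT g set_remove1_subset[of g gs] by (auto intro!: sum_list_T_closed)
    then have S: "coef ?r i \<in> S" "coef g i \<in> S" by auto
    show "coef g i \<in> {0, a}"
    proof (cases "i \<in> {0..int k}")
      case True
      then have "coef g i + coef ?r i = a" using sum f(1) by simp
      then show ?thesis using add_atom_add[of "coef g i" "coef ?r i"] a S by auto
    next
      case False
      then have "coef f i = 0" by (auto simp: f(1))
      then have "coef g i + coef ?r i = 0" using sum by simp
      then show ?thesis using add_eq_0_imp(1) S by blast
    qed
  qed
  have "card (supp (sum_list hs)) \<le> length hs" if "\<forall>h\<in>set hs. card (supp h) \<le> 1"
    for hs :: "(int \<Rightarrow>\<^sub>0 'a) list"
    using that
  proof (induction hs)
    case (Cons h hs)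
    have "card (supp (h + sum_list hs)) \<le> card (supp h \<union> supp (sum_list hs))"
      by (intro card_mono) (use keys_add[of h "sum_list hs"] in auto)
    also have "\<dots> \<le> card (supp h) + card (supp (sum_list hs))"
      by (rule card_Un_le)
    finally show ?case using Cons by fastforce
  qed simp
  then have "card (supp f) \<le> k"
    using one gs(1,3) order_trans by blast
  then show False using card by simp
qed

end

theorem theorem3p6:
  fixes S :: "'a::idom set"
  assumes "semidomain S"
    and "additively_reduced S"
    and "additively_atomic S"
  shows "((add_atoms S = mult_units S \<longleftrightarrow> laurent_goldbach 2 S) \<and>
          (laurent_goldbach 2 S \<longleftrightarrow> (\<exists>k>0. laurent_goldbach k S))) \<and>
         ((add_atoms S = mult_units S \<or> laurent_goldbach 2 S \<or> (\<exists>k>0. laurent_goldbach k S)) \<longrightarrow>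
          (\<forall>f\<in>laurent_polys S. card (Poly_Mapping.keys f) > 1 \<and>
             \<not> binomial_with_unit_coeff S f \<and> \<not> trinomial_with_unit_coeffs S f \<longrightarrow>
             (\<exists>g\<in>mult_irreducibles (laurent_polys S).
              \<exists>h\<in>mult_irreducibles (laurent_polys S). f = g + h)))"
proof -
  interpret reduced_semidomain S
    by unfold_locales (fact assms)+
  \<comment> \<open>With \<open>k = 2\<close> this also gives the step from (2) back to (1).\<close>
  have "add_atoms S = mult_units S" if "laurent_goldbach k S" "k > 0" for k
    using units_eq_add_atomsI[OF assms(3)] add_atom_is_unit[OF that(1) _ that(2)] by blast
  moreover have "laurent_goldbach 2 S" if "add_atoms S = mult_units S"
    using laurent_goldbach_2I[OF assms(3) that] .
  moreover have "(2::nat) > 0" by simp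
  ultimately have equiv: "add_atoms S = mult_units S \<longleftrightarrow> laurent_goldbach 2 S"
    "laurent_goldbach 2 S \<longleftrightarrow> (\<exists>k>0. laurent_goldbach k S)"
    by blast+
  then show ?thesis
    using generic_sum_of_two_irreducibles[OF assms(3)] by blast
qed

end
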